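(* Let $A$ be a definite quaternion algebra over $\mathbb{Q}$ (i.e. ramified at $\infty$) that is ramified at the finite prime $r$. For every positive integer $m$, $m$ is an outlier for $A$ if and only if $m r^2$ is an outlier for $A$.
   Context: An element of $A$ is an integer if its monic minimal polynomial over $\mathbb{Q}$ has coefficients in $\mathbb{Z}$. A positive integer $m$ is an outlier for $A$ if $m$ is the reduced norm of some element of $A$ but not the reduced norm of any integer of $A$ (for definite $A$ over $\mathbb{Q}$ every positive rational is a reduced norm of some element). *)

theory Defs
  imports
    Complex_Main
    "HOL-Computational_Algebra.Computational_Algebra"
    "HOL-Algebra.Module"
    "HOL-Algebra.Algebraic_Closure_Type"
begin

section \<open>Associative algebras over a field\<close>

text \<open>The locale \<^locale>\<open>algebra\<close> of the library only covers commutative algebras.\<close>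

definition assoc_algebra ::
  "('k, 'c) ring_scheme \<Rightarrow> ('k, 'a, 'm) module_scheme \<Rightarrow> bool" where
  "assoc_algebra K A \<longleftrightarrow>
     field K \<and> module K A \<and> ring A \<and>
     (\<forall>c\<in>carrier K. \<forall>x\<in>carrier A. \<forall>y\<in>carrier A.
        (c \<odot>\<^bsub>A\<^esub> x) \<otimes>\<^bsub>A\<^esub> y = c \<odot>\<^bsub>A\<^esub> (x \<otimes>\<^bsub>A\<^esub> y) \<and>
        x \<otimes>\<^bsub>A\<^esub> (c \<odot>\<^bsub>A\<^esub> y) = c \<odot>\<^bsub>A\<^esub> (x \<otimes>\<^bsub>A\<^esub> y))"

definition algebra_iso ::
  "('k, 'c) ring_scheme \<Rightarrow> ('k, 'a, 'm) module_scheme \<Rightarrow> ('k, 'b, 'n) module_scheme \<Rightarrow> ('a \<Rightarrow> 'b) set"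
  where
  "algebra_iso K A B =
     {h \<in> ring_iso A B.
        \<forall>c\<in>carrier K. \<forall>x\<in>carrier A. h (c \<odot>\<^bsub>A\<^esub> x) = c \<odot>\<^bsub>B\<^esub> h x}"

definition skew_field :: "('a, 'm) ring_scheme \<Rightarrow> bool" where
  "skew_field R \<longleftrightarrow> ring R \<and> Units R = carrier R - {\<zero>\<^bsub>R\<^esub>}"


section \<open>Quaternion algebras\<close>

text \<open>
  The algebra $(a,b)_K$: the tuple \<open>(t, x, y, z)\<close> stands for $t + x i + y j + z k$, where
  $i^2 = a$, $j^2 = b$ and $k = i j = - j i$ (hence $k^2 = - a b$).
\<close>

definition hilbert_algebra ::
  "('k, 'c) ring_scheme \<Rightarrow> 'k \<Rightarrow> 'k \<Rightarrow> ('k, 'k \<times> 'k \<times> 'k \<times> 'k) module" where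
  "hilbert_algebra K a b =
     \<lparr>carrier = carrier K \<times> carrier K \<times> carrier K \<times> carrier K,
      monoid.mult = (\<lambda>(t, x, y, z) (t', x', y', z').
        (t \<otimes>\<^bsub>K\<^esub> t' \<oplus>\<^bsub>K\<^esub> a \<otimes>\<^bsub>K\<^esub> (x \<otimes>\<^bsub>K\<^esub> x') \<oplus>\<^bsub>K\<^esub> b \<otimes>\<^bsub>K\<^esub> (y \<otimes>\<^bsub>K\<^esub> y')
           \<ominus>\<^bsub>K\<^esub> a \<otimes>\<^bsub>K\<^esub> b \<otimes>\<^bsub>K\<^esub> (z \<otimes>\<^bsub>K\<^esub> z'),
         t \<otimes>\<^bsub>K\<^esub> x' \<oplus>\<^bsub>K\<^esub> x \<otimes>\<^bsub>K\<^esub> t' \<oplus>\<^bsub>K\<^esub> b \<otimes>\<^bsub>K\<^esub> (z \<otimes>\<^bsub>K\<^esub> y') \<ominus>\<^bsub>K\<^esub> b \<otimes>\<^bsub>K\<^esub> (y \<otimes>\<^bsub>K\<^esub> z'),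
         t \<otimes>\<^bsub>K\<^esub> y' \<oplus>\<^bsub>K\<^esub> y \<otimes>\<^bsub>K\<^esub> t' \<oplus>\<^bsub>K\<^esub> a \<otimes>\<^bsub>K\<^esub> (x \<otimes>\<^bsub>K\<^esub> z') \<ominus>\<^bsub>K\<^esub> a \<otimes>\<^bsub>K\<^esub> (z \<otimes>\<^bsub>K\<^esub> x'),
         t \<otimes>\<^bsub>K\<^esub> z' \<oplus>\<^bsub>K\<^esub> z \<otimes>\<^bsub>K\<^esub> t' \<oplus>\<^bsub>K\<^esub> x \<otimes>\<^bsub>K\<^esub> y' \<ominus>\<^bsub>K\<^esub> y \<otimes>\<^bsub>K\<^esub> x')),
      one = (\<one>\<^bsub>K\<^esub>, \<zero>\<^bsub>K\<^esub>, \<zero>\<^bsub>K\<^esub>, \<zero>\<^bsub>K\<^esub>),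
      zero = (\<zero>\<^bsub>K\<^esub>, \<zero>\<^bsub>K\<^esub>, \<zero>\<^bsub>K\<^esub>, \<zero>\<^bsub>K\<^esub>),
      add = (\<lambda>(t, x, y, z) (t', x', y', z').
        (t \<oplus>\<^bsub>K\<^esub> t', x \<oplus>\<^bsub>K\<^esub> x', y \<oplus>\<^bsub>K\<^esub> y', z \<oplus>\<^bsub>K\<^esub> z')),
      module.smult = (\<lambda>c (t, x, y, z). (c \<otimes>\<^bsub>K\<^esub> t, c \<otimes>\<^bsub>K\<^esub> x, c \<otimes>\<^bsub>K\<^esub> y, c \<otimes>\<^bsub>K\<^esub> z))\<rparr>"

abbreviation rat_field :: "rat ring" where
  "rat_field \<equiv> ring_of_type_algebra"

abbreviation real_field :: "real ring" where
  "real_field \<equiv> ring_of_type_algebra"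

definition has_hilbert_symbol :: "(rat, 'a, 'm) module_scheme \<Rightarrow> rat \<Rightarrow> rat \<Rightarrow> bool" where
  "has_hilbert_symbol A a b \<longleftrightarrow>
     a \<noteq> 0 \<and> b \<noteq> 0 \<and> algebra_iso rat_field (hilbert_algebra rat_field a b) A \<noteq> {}"

definition rat_quaternion_algebra :: "(rat, 'a, 'm) module_scheme \<Rightarrow> bool" where
  "rat_quaternion_algebra A \<longleftrightarrow>
     assoc_algebra rat_field A \<and> (\<exists>a b. has_hilbert_symbol A a b)"

text \<open>
  The standard involution is the unique one as below; the reduced norm is $x \bar x$,
  viewed in the ground field.
\<close>

definition standard_involution :: "(rat, 'a, 'm) module_scheme \<Rightarrow> ('a \<Rightarrow> 'a) \<Rightarrow> bool" where
  "standard_involution A s \<longleftrightarrow>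
     s \<in> carrier A \<rightarrow> carrier A \<and>
     (\<forall>x\<in>carrier A. \<forall>y\<in>carrier A. s (x \<oplus>\<^bsub>A\<^esub> y) = s x \<oplus>\<^bsub>A\<^esub> s y) \<and>
     (\<forall>c. \<forall>x\<in>carrier A. s (c \<odot>\<^bsub>A\<^esub> x) = c \<odot>\<^bsub>A\<^esub> s x) \<and>
     s \<one>\<^bsub>A\<^esub> = \<one>\<^bsub>A\<^esub> \<and>
     (\<forall>x\<in>carrier A. s (s x) = x) \<and>
     (\<forall>x\<in>carrier A. \<forall>y\<in>carrier A. s (x \<otimes>\<^bsub>A\<^esub> y) = s y \<otimes>\<^bsub>A\<^esub> s x) \<and>
     (\<forall>x\<in>carrier A. \<exists>c. x \<otimes>\<^bsub>A\<^esub> s x = c \<odot>\<^bsub>A\<^esub> \<one>\<^bsub>A\<^esub>)"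

definition reduced_norm :: "(rat, 'a, 'm) module_scheme \<Rightarrow> 'a \<Rightarrow> rat" where
  "reduced_norm A x =
     (THE c. \<exists>s. standard_involution A s \<and> x \<otimes>\<^bsub>A\<^esub> s x = c \<odot>\<^bsub>A\<^esub> \<one>\<^bsub>A\<^esub>)"


section \<open>The field of $p$-adic numbers\<close>

definition padic_abs :: "nat \<Rightarrow> rat \<Rightarrow> real" where
  "padic_abs p q =
     (if q = 0 then 0
      else real p powi
        (int (multiplicity (int p) (snd (quotient_of q)))
         - int (multiplicity (int p) (fst (quotient_of q)))))"

definition padic_cauchy_ring :: "nat \<Rightarrow> (nat \<Rightarrow> rat) ring" where
  "padic_cauchy_ring p =
     \<lparr>carrier = {s. \<forall>e>0. \<exists>N. \<forall>m\<ge>N. \<forall>n\<ge>N. padic_abs p (s m - s n) < e},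
      monoid.mult = (\<lambda>s t n. s n * t n), one = (\<lambda>n. 1),
      zero = (\<lambda>n. 0), add = (\<lambda>s t n. s n + t n)\<rparr>"

definition padic_null_ideal :: "nat \<Rightarrow> (nat \<Rightarrow> rat) set" where
  "padic_null_ideal p = {s. (\<lambda>n. padic_abs p (s n)) \<longlonglongrightarrow> 0}"

definition padic_field :: "nat \<Rightarrow> (nat \<Rightarrow> rat) set ring" where
  "padic_field p = padic_cauchy_ring p Quot padic_null_ideal p"

definition padic_of_rat :: "nat \<Rightarrow> rat \<Rightarrow> (nat \<Rightarrow> rat) set" where
  "padic_of_rat p q = padic_null_ideal p +>\<^bsub>padic_cauchy_ring p\<^esub> (\<lambda>n. q)"


section \<open>Ramification\<close>

text \<open>
  For an embedding \<open>f\<close> of the rationals into a field \<open>K\<close>, if \<open>A\<close> is isomorphic to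
  $(a,b)_{\mathbf Q}$ then its scalar extension $A \otimes_{\mathbf Q} K$ is
  $(f(a), f(b))_K$; up to isomorphism the latter does not depend on the choice of \<open>a\<close>, \<open>b\<close>.
\<close>

definition ramified_in ::
  "('k, 'c) ring_scheme \<Rightarrow> (rat \<Rightarrow> 'k) \<Rightarrow> (rat, 'a, 'm) module_scheme \<Rightarrow> bool" where
  "ramified_in K f A \<longleftrightarrow>
     (\<exists>a b. has_hilbert_symbol A a b \<and> skew_field (hilbert_algebra K (f a) (f b)))"

definition ramified_at_prime :: "nat \<Rightarrow> (rat, 'a, 'm) module_scheme \<Rightarrow> bool" where
  "ramified_at_prime p A \<longleftrightarrow> ramified_in (padic_field p) (padic_of_rat p) A"

definition definite :: "(rat, 'a, 'm) module_scheme \<Rightarrow> bool" where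
  "definite A \<longleftrightarrow> ramified_in real_field of_rat A"


section \<open>Integers and outliers\<close>

definition algebra_poly :: "(rat, 'a, 'm) module_scheme \<Rightarrow> rat poly \<Rightarrow> 'a \<Rightarrow> 'a" where
  "algebra_poly A p x =
     (\<Oplus>\<^bsub>A\<^esub>i\<in>{..degree p}. coeff p i \<odot>\<^bsub>A\<^esub> (x [^]\<^bsub>A\<^esub> i))"

definition is_min_poly :: "(rat, 'a, 'm) module_scheme \<Rightarrow> 'a \<Rightarrow> rat poly \<Rightarrow> bool" where
  "is_min_poly A x p \<longleftrightarrow>
     lead_coeff p = 1 \<and> algebra_poly A p x = \<zero>\<^bsub>A\<^esub> \<and>
     (\<forall>q. q \<noteq> 0 \<and> algebra_poly A q x = \<zero>\<^bsub>A\<^esub> \<longrightarrow> degree p \<le> degree q)"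

definition is_integer :: "(rat, 'a, 'm) module_scheme \<Rightarrow> 'a \<Rightarrow> bool" where
  "is_integer A x \<longleftrightarrow>
     x \<in> carrier A \<and> (\<exists>p. is_min_poly A x p \<and> (\<forall>i. coeff p i \<in> \<int>))"

definition outlier :: "(rat, 'a, 'm) module_scheme \<Rightarrow> nat \<Rightarrow> bool" where
  "outlier A m \<longleftrightarrow>
     m > 0 \<and>
     (\<exists>x\<in>carrier A. reduced_norm A x = of_nat m) \<and>
     \<not> (\<exists>x. is_integer A x \<and> reduced_norm A x = of_nat m)"

end

theory Submission
  imports Defs
begin

text \<open>
  Every element of norm \<open>m r\<^sup>2\<close> is \<open>r x\<close> with \<open>x\<close> of norm \<open>m\<close>, and an element is an integer iff
  its reduced trace and norm lie in $\mathbf{Z}$; so it suffices to bound traces at \<open>r\<close>. If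
  $|\mathrm{tr}\, x|_r^2 > |\mathrm{nrd}\, x|_r$, then the reduced characteristic polynomial
  of \<open>x\<close> has a root \<open>\<alpha>\<close> in $\mathbf{Q}_r$, and \<open>x - \<alpha>\<close> has norm \<open>0\<close> in the completion of
  \<open>A\<close> at \<open>r\<close>, a division algebra; so \<open>x = \<alpha>\<close> is rational, where the bound is clear. Hence the
  trace of an element of integral norm is integral at \<open>r\<close>, and \<open>r x\<close> is an integer only if \<open>x\<close>
  is one.
\<close>

section \<open>Nonarchimedean absolute values\<close>

locale nonarchimedean_abs =
  fixes absval :: "'a::field \<Rightarrow> real"
  assumes absval_nonneg [simp]: "0 \<le> absval x"
    and absval_eq_zero_iff [simp]: "absval x = 0 \<longleftrightarrow> x = 0"
    and absval_mult: "absval (x * y) = absval x * absval y"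
    and absval_add_le: "absval (x + y) \<le> max (absval x) (absval y)"
begin

lemma absval_zero [simp]: "absval 0 = 0"
  by simp

lemma not_absval_less_zero [simp]: "\<not> absval x < 0"
  by (simp add: not_less)

lemma absval_one [simp]: "absval 1 = 1"
  using absval_mult[of 1 1] by simp

lemma absval_power: "absval (x ^ n) = absval x ^ n"
  by (induction n) (simp_all add: absval_mult)

lemma absval_minus [simp]: "absval (- x) = absval x"
proof -
  have "absval (- 1) ^ 2 = 1" by (simp flip: absval_power)
  then have "absval (- 1) = 1" using absval_nonneg[of "- 1"] by (simp add: power2_eq_1_iff)
  then show ?thesis using absval_mult[of "- 1" x] by simp
qed

lemma absval_diff_le: "absval (x - y) \<le> max (absval x) (absval y)"
  using absval_add_le[of x "- y"] by simp

lemma absval_divide: "absval (x / y) = absval x / absval y"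
  using absval_mult[of "x / y" y] by (cases "y = 0") (simp_all add: field_simps)

lemma absval_of_nat_le_one: "absval (of_nat n) \<le> 1"
proof (induction n)
  case (Suc n)
  then show ?case using absval_add_le[of 1 "of_nat n"] by simp
qed simp

lemma absval_of_int_le_one: "absval (of_int k) \<le> 1"
  by (cases k rule: int_cases2) (simp_all add: absval_of_nat_le_one)


subsection \<open>Null sequences and Cauchy sequences\<close>

definition null_seq :: "(nat \<Rightarrow> 'a) \<Rightarrow> bool" where
  "null_seq s \<longleftrightarrow> (\<lambda>n. absval (s n)) \<longlonglongrightarrow> 0"

definition cauchy_seq :: "(nat \<Rightarrow> 'a) \<Rightarrow> bool" where
  "cauchy_seq s \<longleftrightarrow> (\<forall>e>0. \<exists>N. \<forall>m\<ge>N. \<forall>n\<ge>N. absval (s m - s n) < e)"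

lemma null_seq_const_iff [simp]: "null_seq (\<lambda>n. c) \<longleftrightarrow> c = 0"
  by (simp add: null_seq_def LIMSEQ_const_iff)

lemma null_seq_uminus: "null_seq s \<Longrightarrow> null_seq (\<lambda>n. - s n)"
  by (simp add: null_seq_def)

lemma null_seq_dominated:
  assumes "\<And>n. absval (s n) \<le> f n" "f \<longlonglongrightarrow> 0"
  shows "null_seq s"
  unfolding null_seq_def
  by (rule tendsto_sandwich[OF _ _ tendsto_const assms(2)]) (simp_all add: assms(1))

lemma null_seq_add:
  assumes "null_seq s" "null_seq t"
  shows "null_seq (\<lambda>n. s n + t n)"
proof (rule null_seq_dominated)
  show "absval (s n + t n) \<le> max (absval (s n)) (absval (t n))" for n
    by (rule absval_add_le)
  show "(\<lambda>n. max (absval (s n)) (absval (t n))) \<longlonglongrightarrow> 0"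
    using tendsto_max assms by (fastforce simp: null_seq_def)
qed

lemma null_seq_mult_Bseq:
  assumes "null_seq s" "Bseq (\<lambda>n. absval (t n))"
  shows "null_seq (\<lambda>n. s n * t n)"
  using bounded_bilinear.Zfun_prod_Bfun[OF bounded_bilinear_mult _ assms(2)] assms(1)
  by (simp add: null_seq_def tendsto_Zfun_iff absval_mult)

lemma cauchy_seq_iff_null_seq_diff:
  "cauchy_seq s \<longleftrightarrow> null_seq (\<lambda>n. s (Suc n) - s n)"
proof
  assume "cauchy_seq s"
  then show "null_seq (\<lambda>n. s (Suc n) - s n)"
    unfolding cauchy_seq_def null_seq_def LIMSEQ_iff by (simp, meson le_Suc_eq)
next
  assume null: "null_seq (\<lambda>n. s (Suc n) - s n)"
  show "cauchy_seq s"
    unfolding cauchy_seq_def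
  proof (intro allI impI)
    fix e :: real
    assume "e > 0"
    then obtain N where N: "absval (s (Suc n) - s n) < e" if "n \<ge> N" for n
      using null by (auto simp: null_seq_def LIMSEQ_iff)
    have tail: "absval (s n - s N) < e" if "n \<ge> N" for n
      using that
    proof (induction n rule: dec_induct)
      case (step n)
      then show ?case
        using N[of n] absval_add_le[of "s (Suc n) - s n" "s n - s N"] by simp
    qed (simp add: \<open>e > 0\<close>)
    have "absval (s m - s n) < e" if "m \<ge> N" "n \<ge> N" for m n
      using tail[OF that(1)] tail[OF that(2)] absval_diff_le[of "s m - s N" "s n - s N"] by simp
    then show "\<exists>N. \<forall>m\<ge>N. \<forall>n\<ge>N. absval (s m - s n) < e" by blast
  qed
qed

lemma cauchy_seq_Bseq:
  assumes "cauchy_seq s"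
  shows "Bseq (\<lambda>n. absval (s n))"
proof -
  obtain N where N: "absval (s n - s N) < 1" if "n \<ge> N" for n
    using assms unfolding cauchy_seq_def by (metis order_refl zero_less_one)
  have "absval (s n) \<le> max 1 (absval (s N))" if "n \<ge> N" for n
    using absval_add_le[of "s n - s N" "s N"] N[OF that] by simp
  then have "eventually (\<lambda>n. norm (absval (s n)) \<le> max 1 (absval (s N))) sequentially"
    by (auto simp: eventually_sequentially)
  then show ?thesis by (rule BfunI)
qed

lemma null_seq_imp_cauchy_seq:
  assumes "null_seq s"
  shows "cauchy_seq s"
proof -
  have "null_seq (\<lambda>n. s (Suc n))"
    using assms unfolding null_seq_def by (rule LIMSEQ_Suc)
  then show ?thesis
    using null_seq_add[OF _ null_seq_uminus[OF assms]] by (simp add: cauchy_seq_iff_null_seq_diff)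
qed

lemma null_seq_mult: "null_seq s \<Longrightarrow> cauchy_seq t \<Longrightarrow> null_seq (\<lambda>n. s n * t n)"
  using null_seq_mult_Bseq cauchy_seq_Bseq by blast

lemma cauchy_seq_const [simp]: "cauchy_seq (\<lambda>n. c)"
  by (simp add: cauchy_seq_iff_null_seq_diff)

lemma cauchy_seq_uminus: "cauchy_seq s \<Longrightarrow> cauchy_seq (\<lambda>n. - s n)"
  unfolding cauchy_seq_iff_null_seq_diff using null_seq_uminus by fastforce

lemma cauchy_seq_add:
  assumes "cauchy_seq s" "cauchy_seq t"
  shows "cauchy_seq (\<lambda>n. s n + t n)"
  using null_seq_add[OF assms[unfolded cauchy_seq_iff_null_seq_diff]]
  by (simp add: cauchy_seq_iff_null_seq_diff add_diff_add)

lemma cauchy_seq_diff: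
  assumes "cauchy_seq s" "cauchy_seq t"
  shows "cauchy_seq (\<lambda>n. s n - t n)"
  using cauchy_seq_add[OF assms(1) cauchy_seq_uminus[OF assms(2)]] by simp

lemma cauchy_seq_mult:
  assumes s: "cauchy_seq s" and t: "cauchy_seq t"
  shows "cauchy_seq (\<lambda>n. s n * t n)"
proof -
  have "Bseq (\<lambda>n. absval (s (Suc n)))"
    using cauchy_seq_Bseq[OF s] Bseq_Suc_iff[of "\<lambda>n. absval (s n)"] by simp
  then have "null_seq (\<lambda>n. (t (Suc n) - t n) * s (Suc n))"
    using t by (intro null_seq_mult_Bseq) (simp_all add: cauchy_seq_iff_null_seq_diff)
  moreover have "null_seq (\<lambda>n. (s (Suc n) - s n) * t n)"
    using s t by (intro null_seq_mult) (simp_all add: cauchy_seq_iff_null_seq_diff[of s])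
  ultimately have "null_seq (\<lambda>n. (t (Suc n) - t n) * s (Suc n) + (s (Suc n) - s n) * t n)"
    by (rule null_seq_add)
  then show ?thesis
    by (simp add: cauchy_seq_iff_null_seq_diff algebra_simps)
qed


subsection \<open>The completion\<close>

definition cauchy_ring :: "(nat \<Rightarrow> 'a) ring" where
  "cauchy_ring =
     \<lparr>carrier = Collect cauchy_seq, monoid.mult = (\<lambda>s t n. s n * t n), one = (\<lambda>n. 1),
      zero = (\<lambda>n. 0), add = (\<lambda>s t n. s n + t n)\<rparr>"

definition completion :: "(nat \<Rightarrow> 'a) set ring" where
  "completion = cauchy_ring Quot Collect null_seq"

definition completion_class :: "(nat \<Rightarrow> 'a) \<Rightarrow> (nat \<Rightarrow> 'a) set" where
  "completion_class = a_r_coset cauchy_ring (Collect null_seq)"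

lemma cauchy_ring_simps [simp]:
  "carrier cauchy_ring = Collect cauchy_seq"
  "s \<otimes>\<^bsub>cauchy_ring\<^esub> t = (\<lambda>n. s n * t n)"
  "s \<oplus>\<^bsub>cauchy_ring\<^esub> t = (\<lambda>n. s n + t n)"
  "\<one>\<^bsub>cauchy_ring\<^esub> = (\<lambda>n. 1)"
  "\<zero>\<^bsub>cauchy_ring\<^esub> = (\<lambda>n. 0)"
  by (simp_all add: cauchy_ring_def)

lemma cring_cauchy_ring: "cring cauchy_ring"
proof (intro cringI abelian_groupI comm_monoidI)
  fix s assume "s \<in> carrier cauchy_ring"
  then show "\<exists>t\<in>carrier cauchy_ring. t \<oplus>\<^bsub>cauchy_ring\<^esub> s = \<zero>\<^bsub>cauchy_ring\<^esub>"
    by (intro bexI[of _ "\<lambda>n. - s n"]) (simp_all add: cauchy_seq_uminus)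
qed (simp_all add: cauchy_seq_add cauchy_seq_mult mult_ac add_ac ring_distribs)

lemma cauchy_ring_uminus:
  assumes "cauchy_seq s"
  shows "\<ominus>\<^bsub>cauchy_ring\<^esub> s = (\<lambda>n. - s n)"
proof -
  interpret cring cauchy_ring by (rule cring_cauchy_ring)
  show ?thesis
    using assms cauchy_seq_uminus[OF assms] by (intro minus_equality) simp_all
qed

lemma ideal_null_seq: "ideal (Collect null_seq) cauchy_ring"
proof -
  interpret cring cauchy_ring by (rule cring_cauchy_ring)
  show ?thesis
  proof (rule idealI)
    show "subgroup (Collect null_seq) (add_monoid cauchy_ring)"
    proof (rule add.subgroupI)
      show "Collect null_seq \<noteq> {}"
        using null_seq_const_iff by blast
      show "\<ominus>\<^bsub>cauchy_ring\<^esub> s \<in> Collect null_seq" if "s \<in> Collect null_seq" for s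
        using that by (simp add: cauchy_ring_uminus null_seq_imp_cauchy_seq null_seq_uminus)
    qed (auto simp: null_seq_imp_cauchy_seq null_seq_add)
    show "s \<otimes>\<^bsub>cauchy_ring\<^esub> t \<in> Collect null_seq" "t \<otimes>\<^bsub>cauchy_ring\<^esub> s \<in> Collect null_seq"
      if "s \<in> Collect null_seq" "t \<in> carrier cauchy_ring" for s t
      using that null_seq_mult[of s t] by (simp_all add: mult.commute)
  qed (rule ring_axioms)
qed

lemma ring_hom_cring_completion_class: "ring_hom_cring cauchy_ring completion completion_class"
  unfolding completion_def completion_class_def
  by (rule ideal.rcos_ring_hom_cring[OF ideal_null_seq cring_cauchy_ring])

lemma completion_class_eq_zero_iff:
  assumes "cauchy_seq s"
  shows "completion_class s = \<zero>\<^bsub>completion\<^esub> \<longleftrightarrow> null_seq s"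
proof -
  interpret ideal "Collect null_seq" cauchy_ring by (rule ideal_null_seq)
  have "\<zero>\<^bsub>completion\<^esub> = Collect null_seq" by (simp add: completion_def FactRing_def)
  then show ?thesis
    using assms rcos_const_imp_mem[of s] a_rcos_zero[OF ideal_axioms, of s]
    by (auto simp: completion_class_def)
qed


subsection \<open>Roots of quadratic polynomials\<close>

text \<open>If \<open>|c| < |b|\<^sup>2\<close> then \<open>X \<mapsto> (X\<^sup>2 + c) / b\<close> is a contraction near \<open>0\<close>; its fixed points are
  the roots of \<open>X\<^sup>2 - bX + c\<close>.\<close>

primrec quadratic_iterate :: "'a \<Rightarrow> 'a \<Rightarrow> nat \<Rightarrow> 'a" where
  "quadratic_iterate b c 0 = 0"
| "quadratic_iterate b c (Suc n) = ((quadratic_iterate b c n)\<^sup>2 + c) / b"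

lemma absval_quadratic_iterate_le:
  assumes "absval c < absval b ^ 2"
  shows "absval (quadratic_iterate b c n) \<le> absval c / absval b"
proof (induction n)
  case (Suc n)
  have "b \<noteq> 0" using assms by auto
  have "absval ((quadratic_iterate b c n)\<^sup>2) \<le> (absval c / absval b) ^ 2"
    using Suc by (simp add: absval_power power_mono)
  also have "\<dots> = absval c * (absval c / absval b ^ 2)"
    by (simp add: power2_eq_square)
  also have "\<dots> \<le> absval c"
    using assms \<open>b \<noteq> 0\<close> by (intro mult_left_le) simp_all
  finally show ?case
    using absval_add_le[of "(quadratic_iterate b c n)\<^sup>2" c] \<open>b \<noteq> 0\<close>
    by (simp add: absval_divide divide_le_cancel)
qed simp

lemma absval_quadratic_iterate_diff_le:
  assumes "absval c < absval b ^ 2"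
  shows "absval (quadratic_iterate b c (Suc n) - quadratic_iterate b c n)
    \<le> absval c / absval b * (absval c / absval b ^ 2) ^ n"
proof (induction n)
  case 0
  then show ?case by (simp add: absval_divide)
next
  case (Suc n)
  let ?y = "quadratic_iterate b c"
  have "?y (Suc (Suc n)) - ?y (Suc n) = (?y (Suc n) - ?y n) * (?y (Suc n) + ?y n) / b"
    by (simp add: power2_eq_square flip: diff_divide_distrib) (simp add: algebra_simps)
  then have "absval (?y (Suc (Suc n)) - ?y (Suc n))
      = absval (?y (Suc n) - ?y n) * (absval (?y (Suc n) + ?y n) / absval b)"
    by (simp only: absval_mult absval_divide times_divide_eq_right)
  also have "\<dots> \<le> absval c / absval b * (absval c / absval b ^ 2) ^ n
      * (absval c / absval b / absval b)"
  proof (intro mult_mono[OF Suc] divide_right_mono)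
    show "absval (?y (Suc n) + ?y n) \<le> absval c / absval b"
      using absval_add_le[of "?y (Suc n)" "?y n"] absval_quadratic_iterate_le[OF assms]
      by (meson max.boundedI order_trans)
  qed simp_all
  finally show ?case by (simp add: power2_eq_square mult_ac)
qed

lemma quadratic_root_in_completion:
  assumes "absval c < absval b ^ 2"
  obtains s where "cauchy_seq s" "null_seq (\<lambda>n. (s n)\<^sup>2 - b * s n + c)"
proof
  let ?y = "quadratic_iterate b c"
  have "b \<noteq> 0" using assms by auto
  then have "(\<lambda>n. absval c / absval b * (absval c / absval b ^ 2) ^ n) \<longlonglongrightarrow> 0"
    using assms by (intro tendsto_mult_right_zero LIMSEQ_realpow_zero) simp_all
  then have null: "null_seq (\<lambda>n. ?y (Suc n) - ?y n)"
    by (rule null_seq_dominated[OF absval_quadratic_iterate_diff_le[OF assms]])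
  then show "cauchy_seq ?y" by (simp only: cauchy_seq_iff_null_seq_diff)
  have "(?y n)\<^sup>2 - b * ?y n + c = (?y (Suc n) - ?y n) * b" for n
    using \<open>b \<noteq> 0\<close> by (simp add: field_simps)
  then show "null_seq (\<lambda>n. (?y n)\<^sup>2 - b * ?y n + c)"
    using null_seq_mult[OF null cauchy_seq_const] by simp
qed

end


section \<open>Quaternion algebras over the completion\<close>

definition hilbert_norm :: "('k, 'c) ring_scheme \<Rightarrow> 'k \<Rightarrow> 'k \<Rightarrow> 'k \<times> 'k \<times> 'k \<times> 'k \<Rightarrow> 'k" where
  "hilbert_norm K a b = (\<lambda>(t, x, y, z).
     t \<otimes>\<^bsub>K\<^esub> t \<ominus>\<^bsub>K\<^esub> a \<otimes>\<^bsub>K\<^esub> (x \<otimes>\<^bsub>K\<^esub> x) \<ominus>\<^bsub>K\<^esub> b \<otimes>\<^bsub>K\<^esub> (y \<otimes>\<^bsub>K\<^esub> y) \<oplus>\<^bsub>K\<^esub> a \<otimes>\<^bsub>K\<^esub> b \<otimes>\<^bsub>K\<^esub> (z \<otimes>\<^bsub>K\<^esub> z))"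

definition hilbert_conj :: "('k, 'c) ring_scheme \<Rightarrow> 'k \<times> 'k \<times> 'k \<times> 'k \<Rightarrow> 'k \<times> 'k \<times> 'k \<times> 'k" where
  "hilbert_conj K = (\<lambda>(t, x, y, z). (t, \<ominus>\<^bsub>K\<^esub> x, \<ominus>\<^bsub>K\<^esub> y, \<ominus>\<^bsub>K\<^esub> z))"

lemma (in cring) hilbert_mult_conj:
  assumes "a \<in> carrier R" "b \<in> carrier R" "v \<in> carrier (hilbert_algebra R a b)"
  shows "v \<otimes>\<^bsub>hilbert_algebra R a b\<^esub> hilbert_conj R v
    = hilbert_norm R a b v \<odot>\<^bsub>hilbert_algebra R a b\<^esub> \<one>\<^bsub>hilbert_algebra R a b\<^esub>"
proof -
  obtain t x y z where v: "v = (t, x, y, z)"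
    and components: "t \<in> carrier R" "x \<in> carrier R" "y \<in> carrier R" "z \<in> carrier R"
    using assms(3) by (auto simp: hilbert_algebra_def)
  have "t \<otimes> t \<oplus> a \<otimes> (x \<otimes> \<ominus> x) \<oplus> b \<otimes> (y \<otimes> \<ominus> y) \<ominus> a \<otimes> b \<otimes> (z \<otimes> \<ominus> z) = hilbert_norm R a b v"
    using assms(1,2) components unfolding v hilbert_norm_def prod.case by algebra
  moreover have "t \<otimes> \<ominus> x \<oplus> x \<otimes> t \<oplus> b \<otimes> (z \<otimes> \<ominus> y) \<ominus> b \<otimes> (y \<otimes> \<ominus> z) = \<zero>"
    "t \<otimes> \<ominus> y \<oplus> y \<otimes> t \<oplus> a \<otimes> (x \<otimes> \<ominus> z) \<ominus> a \<otimes> (z \<otimes> \<ominus> x) = \<zero>"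
    "t \<otimes> \<ominus> z \<oplus> z \<otimes> t \<oplus> x \<otimes> \<ominus> y \<ominus> y \<otimes> \<ominus> x = \<zero>"
    using assms(1,2) components by algebra+
  moreover have "hilbert_norm R a b v \<in> carrier R"
    using assms(1,2) components by (simp add: v hilbert_norm_def)
  ultimately show ?thesis
    by (simp add: v hilbert_conj_def hilbert_algebra_def)
qed

lemma (in ring_hom_cring) hom_hilbert_norm:
  assumes "a \<in> carrier R" "b \<in> carrier R"
    "t \<in> carrier R" "x \<in> carrier R" "y \<in> carrier R" "z \<in> carrier R"
  shows "h (hilbert_norm R a b (t, x, y, z)) = hilbert_norm S (h a) (h b) (h t, h x, h y, h z)"
  using assms by (simp add: hilbert_norm_def a_minus_def)

lemma skew_field_no_zero_divisors:
  assumes "skew_field R" "x \<in> carrier R" "y \<in> carrier R" "x \<otimes>\<^bsub>R\<^esub> y = \<zero>\<^bsub>R\<^esub>"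
  shows "x = \<zero>\<^bsub>R\<^esub> \<or> y = \<zero>\<^bsub>R\<^esub>"
proof (rule disjCI)
  interpret ring R using assms(1) by (simp add: skew_field_def)
  assume "y \<noteq> \<zero>\<^bsub>R\<^esub>"
  then have "y \<in> Units R" using assms by (simp add: skew_field_def)
  then obtain u where "u \<in> carrier R" "y \<otimes>\<^bsub>R\<^esub> u = \<one>\<^bsub>R\<^esub>" by (auto simp: Units_def)
  then have "x = (x \<otimes>\<^bsub>R\<^esub> y) \<otimes>\<^bsub>R\<^esub> u" using assms(2,3) by (simp add: m_assoc)
  then show "x = \<zero>\<^bsub>R\<^esub>" using assms \<open>u \<in> carrier R\<close> by simp
qed

lemma (in cring) skew_field_hilbert_norm_eq_zero:
  assumes skew: "skew_field (hilbert_algebra R a b)" and "a \<in> carrier R" "b \<in> carrier R"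
    and v: "v \<in> carrier (hilbert_algebra R a b)" and norm: "hilbert_norm R a b v = \<zero>"
  shows "v = (\<zero>, \<zero>, \<zero>, \<zero>)"
proof -
  have "v \<otimes>\<^bsub>hilbert_algebra R a b\<^esub> hilbert_conj R v = \<zero>\<^bsub>hilbert_algebra R a b\<^esub>"
    using hilbert_mult_conj[OF assms(2,3) v] by (simp add: norm hilbert_algebra_def)
  moreover have "hilbert_conj R v \<in> carrier (hilbert_algebra R a b)"
    using v by (auto simp: hilbert_conj_def hilbert_algebra_def)
  ultimately have "v = (\<zero>, \<zero>, \<zero>, \<zero>) \<or> hilbert_conj R v = (\<zero>, \<zero>, \<zero>, \<zero>)"
    using skew_field_no_zero_divisors[OF skew v] by (simp add: hilbert_algebra_def)
  then show ?thesis
    using v by (auto simp: hilbert_conj_def hilbert_algebra_def)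
qed

lemma ring_of_type_algebra_simps [simp]:
  "carrier ring_of_type_algebra = UNIV"
  "x \<otimes>\<^bsub>ring_of_type_algebra\<^esub> y = x * y"
  "x \<oplus>\<^bsub>ring_of_type_algebra\<^esub> y = x + y"
  "\<one>\<^bsub>ring_of_type_algebra\<^esub> = 1"
  "\<zero>\<^bsub>ring_of_type_algebra\<^esub> = 0"
  by (simp_all add: ring_of_type_algebra_def)

lemma ring_of_type_algebra_uminus [simp]:
  fixes x :: "'k::comm_ring_1"
  shows "\<ominus>\<^bsub>ring_of_type_algebra\<^esub> x = - x"
proof -
  interpret ring "ring_of_type_algebra :: 'k ring" by (rule ring_from_type_algebra)
  show ?thesis by (rule minus_equality) simp_all
qed

lemma hilbert_norm_ring_of_type_algebra:
  fixes a b t x y z :: "'k::comm_ring_1"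
  shows "hilbert_norm ring_of_type_algebra a b (t, x, y, z)
    = t\<^sup>2 - a * x\<^sup>2 - b * y\<^sup>2 + a * b * z\<^sup>2"
  by (simp add: hilbert_norm_def a_minus_def power2_eq_square)

context nonarchimedean_abs
begin

lemma hilbert_norm_completion_class:
  assumes "cauchy_seq s"
  shows "hilbert_norm completion (completion_class (\<lambda>n. a)) (completion_class (\<lambda>n. b))
      (completion_class s, completion_class (\<lambda>n. x), completion_class (\<lambda>n. y), completion_class (\<lambda>n. z))
    = completion_class (\<lambda>n. hilbert_norm ring_of_type_algebra a b (s n, x, y, z))"
proof -
  interpret ring_hom_cring cauchy_ring completion completion_class
    by (rule ring_hom_cring_completion_class)
  have "hilbert_norm cauchy_ring (\<lambda>n. a) (\<lambda>n. b) (s, \<lambda>n. x, \<lambda>n. y, \<lambda>n. z)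
      = (\<lambda>n. hilbert_norm ring_of_type_algebra a b (s n, x, y, z))"
    by (simp add: hilbert_norm_def a_minus_def cauchy_ring_uminus)
  then show ?thesis
    using hom_hilbert_norm[of "\<lambda>n. a" "\<lambda>n. b" s "\<lambda>n. x" "\<lambda>n. y" "\<lambda>n. z"] assms by simp
qed

lemma absval_trace_square_le_norm:
  assumes skew: "skew_field (hilbert_algebra completion
      (completion_class (\<lambda>n. a)) (completion_class (\<lambda>n. b)))"
  shows "absval (2 * t) ^ 2 \<le> absval (hilbert_norm ring_of_type_algebra a b (t, x, y, z))"
proof (rule ccontr)
  interpret ring_hom_cring cauchy_ring completion completion_class
    by (rule ring_hom_cring_completion_class)
  let ?N = "hilbert_norm ring_of_type_algebra a b"
  assume "\<not> ?thesis"
  then have less: "absval (?N (t, x, y, z)) < absval (2 * t) ^ 2" by simp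
  then obtain \<alpha> where \<alpha>: "cauchy_seq \<alpha>" "null_seq (\<lambda>n. (\<alpha> n)\<^sup>2 - 2 * t * \<alpha> n + ?N (t, x, y, z))"
    by (rule quadratic_root_in_completion)
  define v where "v = (completion_class (\<lambda>n. t - \<alpha> n),
    completion_class (\<lambda>n. x), completion_class (\<lambda>n. y), completion_class (\<lambda>n. z))"
  have diff: "cauchy_seq (\<lambda>n. t - \<alpha> n)"
    using \<alpha>(1) by (intro cauchy_seq_diff cauchy_seq_const)
  have "?N (t - \<alpha> n, x, y, z) = (\<alpha> n)\<^sup>2 - 2 * t * \<alpha> n + ?N (t, x, y, z)" for n
    by (simp add: hilbert_norm_ring_of_type_algebra power2_eq_square algebra_simps)
  then have "hilbert_norm completion (completion_class (\<lambda>n. a)) (completion_class (\<lambda>n. b)) v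
      = completion_class (\<lambda>n. (\<alpha> n)\<^sup>2 - 2 * t * \<alpha> n + ?N (t, x, y, z))"
    by (simp add: v_def hilbert_norm_completion_class[OF diff])
  also have "\<dots> = \<zero>\<^bsub>completion\<^esub>"
    using \<alpha>(2) by (simp add: completion_class_eq_zero_iff null_seq_imp_cauchy_seq)
  finally have "v = (\<zero>\<^bsub>completion\<^esub>, \<zero>\<^bsub>completion\<^esub>, \<zero>\<^bsub>completion\<^esub>, \<zero>\<^bsub>completion\<^esub>)"
    using diff
    by (intro S.skew_field_hilbert_norm_eq_zero[OF skew]) (simp_all add: v_def hilbert_algebra_def)
  then have "x = 0" "y = 0" "z = 0" by (simp_all add: v_def completion_class_eq_zero_iff)
  then have "absval (?N (t, x, y, z)) = absval t ^ 2"
    by (simp add: hilbert_norm_ring_of_type_algebra absval_power)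
  moreover have "absval (2 * t) \<le> absval t"
    using absval_of_nat_le_one[of 2] by (simp add: absval_mult mult_left_le_one_le)
  then have "absval (2 * t) ^ 2 \<le> absval t ^ 2" by (simp add: power_mono)
  ultimately show False using less by simp
qed

end


section \<open>The $p$-adic absolute value\<close>

lemma padic_abs_Fract:
  assumes p: "Factorial_Ring.prime p" and "x \<noteq> 0" "y \<noteq> 0"
  shows "padic_abs p (Rat.Fract x y)
    = real p powi (int (multiplicity (int p) y) - int (multiplicity (int p) x))"
proof -
  obtain n d where quotient: "quotient_of (Rat.Fract x y) = (n, d)" by fastforce
  have "d > 0" using quotient_of_denom_pos[OF quotient] .
  have "Rat.Fract x y = Rat.Fract n d"
    using quotient_of_div[OF quotient] by (simp add: Fract_of_int_quotient)
  then have cross: "x * d = n * y" using \<open>y \<noteq> 0\<close> \<open>d > 0\<close> by (simp add: eq_rat)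
  then have "n \<noteq> 0" using assms(2) \<open>d > 0\<close> by auto
  have "prime_elem (int p)" using p by simp
  then have "multiplicity (int p) x + multiplicity (int p) d
      = multiplicity (int p) n + multiplicity (int p) y"
    using arg_cong[OF cross, of "multiplicity (int p)"] assms(2,3) \<open>d > 0\<close> \<open>n \<noteq> 0\<close>
    by (simp add: prime_elem_multiplicity_mult_distrib)
  then have "int (multiplicity (int p) d) - int (multiplicity (int p) n)
      = int (multiplicity (int p) y) - int (multiplicity (int p) x)" by linarith
  then show ?thesis
    using assms(2,3) quotient by (simp add: padic_abs_def Zero_rat_def eq_rat)
qed

lemma padic_abs_mult:
  assumes p: "Factorial_Ring.prime p"
  shows "padic_abs p (u * v) = padic_abs p u * padic_abs p v"
proof (cases u rule: Rat_cases_nonzero)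
  case (Fract a b)
  note u = this
  show ?thesis
  proof (cases v rule: Rat_cases_nonzero)
    case (Fract c d)
    have "real p \<noteq> 0" "prime_elem (int p)" using p by auto
    then show ?thesis
      using u Fract
      by (simp add: padic_abs_Fract[OF p] prime_elem_multiplicity_mult_distrib
          algebra_simps flip: power_int_add)
  qed (simp add: padic_abs_def)
qed (simp add: padic_abs_def)

lemma padic_abs_add_le:
  assumes p: "Factorial_Ring.prime p"
  shows "padic_abs p (u + v) \<le> max (padic_abs p u) (padic_abs p v)"
proof (cases "u = 0 \<or> v = 0 \<or> u + v = 0")
  case True
  then show ?thesis by (auto simp: padic_abs_def le_max_iff_disj)
next
  case False
  obtain a b where u: "u = Rat.Fract a b" "a \<noteq> 0" "b > 0"
    using False by (cases u rule: Rat_cases_nonzero) auto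
  obtain c d where v: "v = Rat.Fract c d" "c \<noteq> 0" "d > 0"
    using False by (cases v rule: Rat_cases_nonzero) auto
  let ?m = "multiplicity (int p)"
  have common: "u = Rat.Fract (a * d) (b * d)" "v = Rat.Fract (c * b) (b * d)"
      "u + v = Rat.Fract (a * d + c * b) (b * d)"
    using u v by (simp_all add: eq_rat)
  then have nonzero: "a * d \<noteq> 0" "c * b \<noteq> 0" "a * d + c * b \<noteq> 0" "b * d \<noteq> 0"
    using False u v by (auto simp: rat_number_collapse)
  have "min (?m (a * d)) (?m (c * b)) \<le> ?m (a * d + c * b)"
  proof (rule multiplicity_geI)
    show "int p ^ min (?m (a * d)) (?m (c * b)) dvd a * d + c * b"
      by (intro dvd_add multiplicity_dvd') simp_all
  qed (use nonzero p in \<open>auto simp: prime_int_iff\<close>)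
  then have "int (?m (b * d)) - int (?m (a * d + c * b)) \<le> int (?m (b * d)) - int (?m (a * d))
      \<or> int (?m (b * d)) - int (?m (a * d + c * b)) \<le> int (?m (b * d)) - int (?m (c * b))"
    by linarith
  then show ?thesis
    unfolding common(3) unfolding common(1,2) le_max_iff_disj
      padic_abs_Fract[OF p nonzero(1,4)] padic_abs_Fract[OF p nonzero(2,4)]
      padic_abs_Fract[OF p nonzero(3,4)]
    using prime_ge_1_nat[OF p] by (auto intro: power_int_increasing)
qed

lemma nonarchimedean_abs_padic_abs:
  assumes "Factorial_Ring.prime p"
  shows "nonarchimedean_abs (padic_abs p)"
proof
  show "0 \<le> padic_abs p x" "padic_abs p x = 0 \<longleftrightarrow> x = 0" for x
    using assms by (auto simp: padic_abs_def)
qed (simp_all add: assms padic_abs_mult padic_abs_add_le)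

lemma Ints_if_padic_abs_le_one:
  assumes p: "Factorial_Ring.prime p" and "of_nat p * q \<in> \<int>" and integral: "padic_abs p q \<le> 1"
  shows "q \<in> \<int>"
proof -
  obtain k where k: "of_nat p * q = of_int k" using assms(2) by (auto elim: Ints_cases)
  have "p > 1" using p by (rule prime_gt_1_nat)
  then have q: "q = Rat.Fract k (int p)" using k by (simp add: Fract_of_int_quotient field_simps)
  have "int p dvd k"
  proof (rule ccontr)
    assume "\<not> int p dvd k"
    moreover from this have "k \<noteq> 0" by auto
    ultimately have "padic_abs p q = real p"
      using \<open>p > 1\<close> p
      by (simp add: q padic_abs_Fract not_dvd_imp_multiplicity_0 multiplicity_self)
    then show False using integral \<open>p > 1\<close> by simp
  qed
  then obtain l where "k = int p * l" by blast
  then have "q = of_int l" using k \<open>p > 1\<close> by simp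
  then show ?thesis by simp
qed

lemma
  assumes "Factorial_Ring.prime p"
  shows padic_field_eq_completion:
      "padic_field p = nonarchimedean_abs.completion (padic_abs p)"
    and padic_of_rat_eq_completion_class:
      "padic_of_rat p q = nonarchimedean_abs.completion_class (padic_abs p) (\<lambda>n. q)"
proof -
  interpret nonarchimedean_abs "padic_abs p" by (rule nonarchimedean_abs_padic_abs[OF assms])
  have "padic_cauchy_ring p = cauchy_ring"
    by (simp add: padic_cauchy_ring_def cauchy_ring_def cauchy_seq_def[abs_def])
  moreover have "padic_null_ideal p = Collect null_seq"
    by (simp add: padic_null_ideal_def null_seq_def[abs_def])
  ultimately show "padic_field p = completion" "padic_of_rat p q = completion_class (\<lambda>n. q)"
    by (simp_all add: padic_field_def completion_def padic_of_rat_def completion_class_def)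
qed

section \<open>Rational algebras and minimal polynomials\<close>

locale rat_algebra =
  fixes A :: "(rat, 'a, 'm) module_scheme" (structure)
  assumes assoc_algebra: "assoc_algebra rat_field A"
    and one_not_zero [simp]: "\<one> \<noteq> \<zero>"

sublocale rat_algebra \<subseteq> ring A
  using assoc_algebra by (simp add: assoc_algebra_def)

sublocale rat_algebra \<subseteq> module: module rat_field A
  using assoc_algebra by (simp add: assoc_algebra_def)

context rat_algebra
begin

lemma
  assumes "x \<in> carrier A"
  shows smult_closed_rat [simp]: "c \<odot> x \<in> carrier A"
    and smult_add_left: "(c + d) \<odot> x = c \<odot> x \<oplus> d \<odot> x"
    and smult_smult: "c \<odot> (d \<odot> x) = (c * d) \<odot> x"
    and smult_one_rat [simp]: "1 \<odot> x = x"
    and smult_zero_rat [simp]: "0 \<odot> x = \<zero>"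
    and smult_uminus_left: "(- c) \<odot> x = \<ominus> (c \<odot> x)"
  using assms module.smult_closed[of c x] module.smult_l_distr[of c d x]
    module.smult_assoc1[of c d x] module.smult_one[of x] module.smult_l_null[of x]
    module.smult_l_minus[of c x]
  by simp_all

lemma smult_add_right:
  "x \<in> carrier A \<Longrightarrow> y \<in> carrier A \<Longrightarrow> c \<odot> (x \<oplus> y) = c \<odot> x \<oplus> c \<odot> y"
  using module.smult_r_distr[of c x y] by simp

lemma smult_mult_left: "x \<in> carrier A \<Longrightarrow> y \<in> carrier A \<Longrightarrow> (c \<odot> x) \<otimes> y = c \<odot> (x \<otimes> y)"
  using assoc_algebra by (simp add: assoc_algebra_def)

lemma smult_mult_right: "x \<in> carrier A \<Longrightarrow> y \<in> carrier A \<Longrightarrow> x \<otimes> (c \<odot> y) = c \<odot> (x \<otimes> y)"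
  using assoc_algebra by (simp add: assoc_algebra_def)

lemma smult_diff_left: "x \<in> carrier A \<Longrightarrow> (c - d) \<odot> x = c \<odot> x \<ominus> d \<odot> x"
  using smult_add_left[of x c "- d"] by (simp add: smult_uminus_left a_minus_def)

lemma smult_eq_zero_iff:
  assumes "x \<in> carrier A"
  shows "c \<odot> x = \<zero> \<longleftrightarrow> c = 0 \<or> x = \<zero>"
proof
  assume "c \<odot> x = \<zero>"
  then have "inverse c \<odot> (c \<odot> x) = \<zero>" by simp
  then show "c = 0 \<or> x = \<zero>" using assms by (cases "c = 0") (simp_all add: smult_smult)
qed (use assms in auto)

lemma smult_one_eq_iff [simp]: "c \<odot> \<one> = d \<odot> \<one> \<longleftrightarrow> c = d"
  using smult_eq_zero_iff[of \<one> "c - d"] by (simp add: smult_diff_left)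

lemma lin_indep_one:
  assumes x: "x \<in> carrier A" "x \<notin> range (\<lambda>c. c \<odot> \<one>)" and relation: "c \<odot> \<one> \<oplus> d \<odot> x = \<zero>"
  shows "c = 0 \<and> d = 0"
proof -
  have "d = 0"
  proof (rule ccontr)
    assume "d \<noteq> 0"
    have "(- d) \<odot> x = c \<odot> \<one>"
      using minus_equality[OF relation] x(1) by (simp add: smult_uminus_left)
    then have "inverse (- d) \<odot> ((- d) \<odot> x) = inverse (- d) \<odot> (c \<odot> \<one>)" by simp
    then have "x = (inverse (- d) * c) \<odot> \<one>" using x(1) \<open>d \<noteq> 0\<close> by (simp add: smult_smult)
    then show False using x(2) by blast
  qed
  then show ?thesis using relation x(1) by (simp add: smult_eq_zero_iff)
qed

lemma algebra_poly_eq_finsum: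
  assumes "x \<in> carrier A" "degree p \<le> n"
  shows "algebra_poly A p x = (\<Oplus>i\<in>{..n}. poly.coeff p i \<odot> x [^] i)"
  unfolding algebra_poly_def
  by (rule add.finprod_mono_neutral_cong_left) (use assms in \<open>auto simp: coeff_eq_0\<close>)

lemma algebra_poly_add:
  assumes "x \<in> carrier A"
  shows "algebra_poly A (p + q) x = algebra_poly A p x \<oplus> algebra_poly A q x"
proof -
  define n where "n = max (degree p) (degree q)"
  have "algebra_poly A (p + q) x = (\<Oplus>i\<in>{..n}. poly.coeff p i \<odot> x [^] i \<oplus> poly.coeff q i \<odot> x [^] i)"
    using assms by (simp add: algebra_poly_eq_finsum[of x _ n] n_def degree_add_le_max smult_add_left)
  also have "\<dots> = (\<Oplus>i\<in>{..n}. poly.coeff p i \<odot> x [^] i) \<oplus> (\<Oplus>i\<in>{..n}. poly.coeff q i \<odot> x [^] i)"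
    using assms by (intro finsum_addf) auto
  also have "\<dots> = algebra_poly A p x \<oplus> algebra_poly A q x"
    using assms by (simp add: algebra_poly_eq_finsum[of x _ n] n_def)
  finally show ?thesis .
qed

lemma is_min_poly_unique:
  assumes x: "x \<in> carrier A" and p: "is_min_poly A x p" and q: "is_min_poly A x q"
  shows "p = q"
proof (rule ccontr)
  assume "p \<noteq> q"
  have "algebra_poly A (p - q) x \<in> carrier A"
    using x by (simp add: algebra_poly_def)
  moreover have "algebra_poly A p x = algebra_poly A (p - q) x \<oplus> algebra_poly A q x"
    using algebra_poly_add[OF x, of "p - q" q] by simp
  ultimately have "algebra_poly A (p - q) x = \<zero>"
    using p q by (simp add: is_min_poly_def)
  then have degree_le: "degree p \<le> degree (p - q)"
    using p \<open>p \<noteq> q\<close> by (simp add: is_min_poly_def)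
  have "p \<noteq> 0" "q \<noteq> 0" using p q by (auto simp: is_min_poly_def)
  then have "degree p = degree q"
    using p q by (intro antisym) (simp_all add: is_min_poly_def)
  then have "degree (p - q) = degree p" "poly.coeff (p - q) (degree p) = 0"
    using degree_le p q degree_diff_le_max[of p q] by (simp_all add: is_min_poly_def)
  then show False using \<open>p \<noteq> q\<close> leading_coeff_0_iff[of "p - q"] by simp
qed

lemma is_integer_iff_min_poly:
  assumes "x \<in> carrier A" "is_min_poly A x p"
  shows "is_integer A x \<longleftrightarrow> (\<forall>i. poly.coeff p i \<in> \<int>)"
  using assms is_min_poly_unique unfolding is_integer_def by blast

lemma algebra_poly_degree_le_one:
  assumes "x \<in> carrier A" "degree p \<le> 1"
  shows "algebra_poly A p x = poly.coeff p 0 \<odot> \<one> \<oplus> poly.coeff p 1 \<odot> x"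
  using assms by (simp add: algebra_poly_eq_finsum[of x p 1] a_comm)

lemma algebra_poly_degree_le_two:
  assumes "x \<in> carrier A" "degree p \<le> 2"
  shows "algebra_poly A p x = poly.coeff p 0 \<odot> \<one> \<oplus> poly.coeff p 1 \<odot> x \<oplus> poly.coeff p 2 \<odot> (x \<otimes> x)"
  using assms
  by (simp add: algebra_poly_eq_finsum[of x p 2] numeral_2_eq_2 a_ac)

lemma is_min_poly_scalar: "is_min_poly A (c \<odot> \<one>) [:- c, 1:]"
proof -
  have "1 \<le> degree q" if "q \<noteq> 0" "algebra_poly A q (c \<odot> \<one>) = \<zero>" for q
  proof (rule ccontr)
    assume "\<not> 1 \<le> degree q"
    then have "degree q = 0" by simp
    then have "lead_coeff q \<odot> \<one> = \<zero>"
      using that algebra_poly_degree_le_one[of "c \<odot> \<one>" q] by (simp add: coeff_eq_0)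
    then show False using \<open>q \<noteq> 0\<close> by (simp add: smult_eq_zero_iff)
  qed
  moreover have "algebra_poly A [:- c, 1:] (c \<odot> \<one>) = \<zero>"
    by (simp add: algebra_poly_degree_le_one smult_uminus_left l_neg)
  ultimately show ?thesis by (simp add: is_min_poly_def)
qed

lemma is_min_poly_quadratic:
  assumes x: "x \<in> carrier A" "x \<notin> range (\<lambda>c. c \<odot> \<one>)"
    and square: "x \<otimes> x = t \<odot> x \<ominus> n \<odot> \<one>"
  shows "is_min_poly A x [:n, - t, 1:]"
proof -
  have "2 \<le> degree q" if "q \<noteq> 0" "algebra_poly A q x = \<zero>" for q
  proof (rule ccontr)
    assume "\<not> 2 \<le> degree q"
    then have deg: "degree q \<le> 1" by simp
    then have "poly.coeff q 0 \<odot> \<one> \<oplus> poly.coeff q 1 \<odot> x = \<zero>"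
      using that(2) x(1) by (simp add: algebra_poly_degree_le_one)
    then have zero: "poly.coeff q 0 = 0" "poly.coeff q 1 = 0" using lin_indep_one[OF x] by blast+
    consider "degree q = 0" | "degree q = 1" using deg by linarith
    then have "lead_coeff q = 0" by cases (simp_all only: zero)
    then show False using \<open>q \<noteq> 0\<close> by simp
  qed
  moreover have "algebra_poly A [:n, - t, 1:] x = \<zero>"
  proof -
    have "algebra_poly A [:n, - t, 1:] x = n \<odot> \<one> \<oplus> \<ominus> (t \<odot> x) \<oplus> (t \<odot> x \<ominus> n \<odot> \<one>)"
      using x(1) by (simp add: algebra_poly_degree_le_two square numeral_2_eq_2 smult_uminus_left)
    also have "\<dots> = \<zero>"
      using x(1) smult_closed_rat[of x t] smult_closed_rat[of \<one> n] by algebra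
    finally show ?thesis .
  qed
  ultimately show ?thesis by (simp add: is_min_poly_def numeral_2_eq_2)
qed

end


section \<open>Standard involutions, reduced traces and reduced bex_norm_iff\<close>

lemma
  assumes "standard_involution A s" "x \<in> carrier A"
  shows standard_involution_closed: "s x \<in> carrier A"
    and standard_involution_smult: "s (c \<odot>\<^bsub>A\<^esub> x) = c \<odot>\<^bsub>A\<^esub> s x"
    and standard_involution_mult_scalar: "\<exists>n. x \<otimes>\<^bsub>A\<^esub> s x = n \<odot>\<^bsub>A\<^esub> \<one>\<^bsub>A\<^esub>"
  using assms by (simp_all only: standard_involution_def Pi_iff)

lemma standard_involution_one: "standard_involution A s \<Longrightarrow> s \<one>\<^bsub>A\<^esub> = \<one>\<^bsub>A\<^esub>"
  by (simp only: standard_involution_def)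

lemma standard_involution_add:
  assumes "standard_involution A s" "x \<in> carrier A" "y \<in> carrier A"
  shows "s (x \<oplus>\<^bsub>A\<^esub> y) = s x \<oplus>\<^bsub>A\<^esub> s y"
  using assms by (simp only: standard_involution_def)

context rat_algebra
begin

lemma standard_involution_scalar:
  assumes "standard_involution A s"
  shows "s (c \<odot> \<one>) = c \<odot> \<one>"
  unfolding standard_involution_smult[OF assms one_closed] standard_involution_one[OF assms] ..

text \<open>The trace is read off from \<open>(x + 1)(s x + 1)\<close>, which is again a scalar.\<close>

lemma standard_involution_trace_exists:
  assumes s: "standard_involution A s" and x: "x \<in> carrier A"
  obtains t where "x \<oplus> s x = t \<odot> \<one>"
proof -
  have s_closed: "s x \<in> carrier A" by (rule standard_involution_closed[OF s x])
  obtain n where n: "x \<otimes> s x = n \<odot> \<one>" using standard_involution_mult_scalar[OF s x] by blast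
  obtain d where "(x \<oplus> \<one>) \<otimes> s (x \<oplus> \<one>) = d \<odot> \<one>"
    using standard_involution_mult_scalar[OF s, of "x \<oplus> \<one>"] x by auto
  then have d: "(x \<oplus> \<one>) \<otimes> (s x \<oplus> \<one>) = d \<odot> \<one>"
    using x by (simp add: standard_involution_add[OF s] standard_involution_one[OF s])
  have "x \<oplus> s x = (x \<oplus> \<one>) \<otimes> (s x \<oplus> \<one>) \<ominus> x \<otimes> s x \<ominus> \<one>"
    using x s_closed r_one[OF x] by algebra
  also have "\<dots> = (d - n - 1) \<odot> \<one>"
    by (simp add: d n smult_diff_left)
  finally show ?thesis by (rule that)
qed

lemma standard_involution_square:
  assumes s: "standard_involution A s" and x: "x \<in> carrier A"
    and t: "x \<oplus> s x = t \<odot> \<one>" and n: "x \<otimes> s x = n \<odot> \<one>"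
  shows "x \<otimes> x = t \<odot> x \<ominus> n \<odot> \<one>"
proof -
  have "s x \<in> carrier A" by (rule standard_involution_closed[OF s x])
  then have "x \<otimes> x = x \<otimes> (x \<oplus> s x) \<ominus> x \<otimes> s x" using x by algebra
  then show ?thesis using x by (simp add: t n smult_mult_right)
qed

lemma standard_involution_unique:
  assumes s: "standard_involution A s" and s': "standard_involution A s'" and x: "x \<in> carrier A"
  shows "s x = s' x"
proof (cases "x \<in> range (\<lambda>c. c \<odot> \<one>)")
  case True
  then show ?thesis by (auto simp: standard_involution_scalar[OF s] standard_involution_scalar[OF s'])
next
  case False
  have closed: "s x \<in> carrier A" "s' x \<in> carrier A"
    using standard_involution_closed[OF s x] standard_involution_closed[OF s' x] .
  obtain t t' where t: "x \<oplus> s x = t \<odot> \<one>" "x \<oplus> s' x = t' \<odot> \<one>"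
    using standard_involution_trace_exists s s' x by metis
  obtain n n' where n: "x \<otimes> s x = n \<odot> \<one>" "x \<otimes> s' x = n' \<odot> \<one>"
    using standard_involution_mult_scalar s s' x by metis
  have "t \<odot> x \<ominus> n \<odot> \<one> = t' \<odot> x \<ominus> n' \<odot> \<one>"
    using standard_involution_square[OF s x t(1) n(1)]
      standard_involution_square[OF s' x t(2) n(2)] by simp
  then have "(t \<odot> x \<ominus> n \<odot> \<one>) \<ominus> (t' \<odot> x \<ominus> n' \<odot> \<one>) = \<zero>"
    using x by (simp add: r_neg a_minus_def)
  moreover have "(t \<odot> x \<ominus> n \<odot> \<one>) \<ominus> (t' \<odot> x \<ominus> n' \<odot> \<one>)
      = (n' \<odot> \<one> \<ominus> n \<odot> \<one>) \<oplus> (t \<odot> x \<ominus> t' \<odot> x)"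
    using smult_closed_rat[OF x, of t] smult_closed_rat[OF x, of t']
      smult_closed_rat[OF one_closed, of n] smult_closed_rat[OF one_closed, of n'] by algebra
  ultimately have "(n' - n) \<odot> \<one> \<oplus> (t - t') \<odot> x = \<zero>" using x by (simp add: smult_diff_left)
  then have "t = t'" using lin_indep_one[OF x False] by fastforce
  then have "x \<oplus> s x = x \<oplus> s' x" using t by simp
  then show ?thesis using x closed by simp
qed

end

lemma Ints_if_power_Ints:
  fixes q :: rat
  assumes "q ^ n \<in> \<int>" "n > 0"
  shows "q \<in> \<int>"
proof (rule rational_algebraic_int_is_int)
  show "algebraic_int q"
    by (rule algebraic_int_root[of "q ^ n" "monom 1 n"])
      (use assms in \<open>auto simp: poly_monom degree_monom_eq int_imp_algebraic_int\<close>)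
  show "q \<in> \<rat>" by (cases q) (simp add: Fract_of_int_quotient)
qed

definition reduced_trace :: "(rat, 'a, 'm) module_scheme \<Rightarrow> 'a \<Rightarrow> rat" where
  "reduced_trace A x =
     (THE t. \<exists>s. standard_involution A s \<and> x \<oplus>\<^bsub>A\<^esub> s x = t \<odot>\<^bsub>A\<^esub> \<one>\<^bsub>A\<^esub>)"

locale rat_involutive_algebra = rat_algebra +
  fixes conj :: "'a \<Rightarrow> 'a"
  assumes conj: "standard_involution A conj"
begin

lemma conj_closed [simp]: "x \<in> carrier A \<Longrightarrow> conj x \<in> carrier A"
  by (rule standard_involution_closed[OF conj])

lemma reduced_norm_eqI:
  assumes "x \<in> carrier A" "x \<otimes> conj x = n \<odot> \<one>"
  shows "reduced_norm A x = n"
  unfolding reduced_norm_def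
proof (rule the_equality)
  show "\<exists>s. standard_involution A s \<and> x \<otimes> s x = n \<odot> \<one>"
    using assms(2) conj by blast
  fix n' assume "\<exists>s. standard_involution A s \<and> x \<otimes> s x = n' \<odot> \<one>"
  then have "n' \<odot> \<one> = n \<odot> \<one>"
    using standard_involution_unique[OF _ conj assms(1)] assms(2) by metis
  then show "n' = n" by simp
qed

lemma reduced_trace_eqI:
  assumes "x \<in> carrier A" "x \<oplus> conj x = t \<odot> \<one>"
  shows "reduced_trace A x = t"
  unfolding reduced_trace_def
proof (rule the_equality)
  show "\<exists>s. standard_involution A s \<and> x \<oplus> s x = t \<odot> \<one>"
    using assms(2) conj by blast
  fix t' assume "\<exists>s. standard_involution A s \<and> x \<oplus> s x = t' \<odot> \<one>"
  then have "t' \<odot> \<one> = t \<odot> \<one>"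
    using standard_involution_unique[OF _ conj assms(1)] assms(2) by metis
  then show "t' = t" by simp
qed

lemma mult_conj: "x \<in> carrier A \<Longrightarrow> x \<otimes> conj x = reduced_norm A x \<odot> \<one>"
  using standard_involution_mult_scalar[OF conj] reduced_norm_eqI by metis

lemma add_conj: "x \<in> carrier A \<Longrightarrow> x \<oplus> conj x = reduced_trace A x \<odot> \<one>"
  using standard_involution_trace_exists[OF conj] reduced_trace_eqI by metis

lemma reduced_norm_smult:
  assumes x: "x \<in> carrier A"
  shows "reduced_norm A (c \<odot> x) = c\<^sup>2 * reduced_norm A x"
proof (rule reduced_norm_eqI)
  have "c \<odot> x \<otimes> conj (c \<odot> x) = (c * c) \<odot> (x \<otimes> conj x)"
    using x by (simp add: standard_involution_smult[OF conj] smult_mult_left smult_mult_right smult_smult)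
  then show "c \<odot> x \<otimes> conj (c \<odot> x) = (c\<^sup>2 * reduced_norm A x) \<odot> \<one>"
    using x by (simp add: mult_conj smult_smult power2_eq_square)
qed (use x in simp)

lemma reduced_trace_smult:
  assumes x: "x \<in> carrier A"
  shows "reduced_trace A (c \<odot> x) = c * reduced_trace A x"
proof (rule reduced_trace_eqI)
  have "c \<odot> x \<oplus> conj (c \<odot> x) = c \<odot> (x \<oplus> conj x)"
    using x by (simp add: standard_involution_smult[OF conj] smult_add_right)
  then show "c \<odot> x \<oplus> conj (c \<odot> x) = (c * reduced_trace A x) \<odot> \<one>"
    using x by (simp add: add_conj smult_smult)
qed (use x in simp)

lemma reduced_norm_one: "reduced_norm A \<one> = 1"
  by (rule reduced_norm_eqI) (simp_all add: standard_involution_one[OF conj])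

lemma reduced_trace_one: "reduced_trace A \<one> = 2"
  using smult_add_left[OF one_closed, of 1 1]
  by (intro reduced_trace_eqI) (simp_all add: standard_involution_one[OF conj])

theorem is_integer_iff:
  assumes x: "x \<in> carrier A"
  shows "is_integer A x \<longleftrightarrow> reduced_trace A x \<in> \<int> \<and> reduced_norm A x \<in> \<int>"
proof (cases "x \<in> range (\<lambda>c. c \<odot> \<one>)")
  case True
  then obtain c where c: "x = c \<odot> \<one>" by blast
  have "is_integer A x \<longleftrightarrow> c \<in> \<int>"
    unfolding c is_integer_iff_min_poly[OF smult_closed_rat[OF one_closed] is_min_poly_scalar]
    by (auto simp: coeff_pCons split: nat.splits)
  also have "\<dots> \<longleftrightarrow> c * 2 \<in> \<int> \<and> c\<^sup>2 \<in> \<int>"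
    using Ints_if_power_Ints[of c 2] by auto
  finally show ?thesis
    by (simp add: c reduced_norm_smult reduced_trace_smult reduced_norm_one reduced_trace_one)
next
  case False
  have "x \<otimes> x = reduced_trace A x \<odot> x \<ominus> reduced_norm A x \<odot> \<one>"
    using standard_involution_square[OF conj x] add_conj mult_conj x by blast
  then have "is_integer A x \<longleftrightarrow>
      (\<forall>i. poly.coeff [:reduced_norm A x, - reduced_trace A x, 1:] i \<in> \<int>)"
    using is_min_poly_quadratic[OF x False] is_integer_iff_min_poly[OF x] by blast
  also have "\<dots> \<longleftrightarrow> reduced_trace A x \<in> \<int> \<and> reduced_norm A x \<in> \<int>"
    by (auto simp: coeff_pCons minus_in_Ints_iff split: nat.splits)
  finally show ?thesis .
qed

lemma bex_reduced_norm_smult_iff: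
  assumes "c \<noteq> 0"
  shows "(\<exists>y\<in>carrier A. P y \<and> reduced_norm A y = q * c\<^sup>2) \<longleftrightarrow>
    (\<exists>x\<in>carrier A. P (c \<odot> x) \<and> reduced_norm A x = q)"
proof
  assume "\<exists>y\<in>carrier A. P y \<and> reduced_norm A y = q * c\<^sup>2"
  then obtain y where y: "y \<in> carrier A" "P y" "reduced_norm A y = q * c\<^sup>2" by blast
  then have "P (c \<odot> (inverse c \<odot> y))" "reduced_norm A (inverse c \<odot> y) = q"
    using assms by (simp_all add: smult_smult reduced_norm_smult field_simps)
  then show "\<exists>x\<in>carrier A. P (c \<odot> x) \<and> reduced_norm A x = q"
    using y(1) smult_closed_rat by blast
next
  assume "\<exists>x\<in>carrier A. P (c \<odot> x) \<and> reduced_norm A x = q"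
  then obtain x where x: "x \<in> carrier A" "P (c \<odot> x)" "reduced_norm A x = q" by blast
  then have "reduced_norm A (c \<odot> x) = q * c\<^sup>2" by (simp add: reduced_norm_smult)
  then show "\<exists>y\<in>carrier A. P y \<and> reduced_norm A y = q * c\<^sup>2"
    using x smult_closed_rat by blast
qed

end

locale rat_involutive_algebra_iso = B: rat_involutive_algebra B s
  for B :: "(rat, 'b, 'n) module_scheme" and s +
  fixes A :: "(rat, 'a, 'm) module_scheme" (structure) and h :: "'b \<Rightarrow> 'a"
  assumes assoc_algebra_image: "assoc_algebra rat_field A"
    and iso: "h \<in> algebra_iso rat_field B A"
begin

lemma ring_iso: "h \<in> ring_iso B A"
  using iso by (simp add: algebra_iso_def)

lemma hom_closed [simp]: "u \<in> carrier B \<Longrightarrow> h u \<in> carrier A"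
  by (rule ring_iso_memE(1)[OF ring_iso])

lemma hom_mult: "u \<in> carrier B \<Longrightarrow> v \<in> carrier B \<Longrightarrow> h (u \<otimes>\<^bsub>B\<^esub> v) = h u \<otimes> h v"
  by (rule ring_iso_memE(2)[OF ring_iso])

lemma hom_add: "u \<in> carrier B \<Longrightarrow> v \<in> carrier B \<Longrightarrow> h (u \<oplus>\<^bsub>B\<^esub> v) = h u \<oplus> h v"
  by (rule ring_iso_memE(3)[OF ring_iso])

lemma hom_one: "h \<one>\<^bsub>B\<^esub> = \<one>"
  by (rule ring_iso_memE(4)[OF ring_iso])

lemma hom_smult: "u \<in> carrier B \<Longrightarrow> h (c \<odot>\<^bsub>B\<^esub> u) = c \<odot> h u"
  using iso by (simp add: algebra_iso_def)

lemma carrier_eq_image: "carrier A = h ` carrier B"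
  using ring_iso_memE(5)[OF ring_iso] by (simp add: bij_betw_def)

definition transported_conj :: "'a \<Rightarrow> 'a" where
  "transported_conj x = h (s (inv_into (carrier B) h x))"

lemma transported_conj_hom: "u \<in> carrier B \<Longrightarrow> transported_conj (h u) = h (s u)"
  using ring_iso_memE(5)[OF ring_iso] by (simp add: transported_conj_def bij_betw_def)

lemma standard_involution_transported_conj: "standard_involution A transported_conj"
proof -
  have "\<exists>c. h u \<otimes> h (s u) = c \<odot> \<one>" if "u \<in> carrier B" for u
    using that B.mult_conj[of u] by (metis B.conj_closed B.one_closed hom_mult hom_one hom_smult)
  then show ?thesis
    using B.conj
    by (auto simp: standard_involution_def carrier_eq_image transported_conj_hom
        simp flip: hom_mult hom_add hom_smult hom_one)
qed

sublocale rat_involutive_algebra A transported_conj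
proof
  show "assoc_algebra rat_field A" "standard_involution A transported_conj"
    by (rule assoc_algebra_image standard_involution_transported_conj)+
  have "h \<zero>\<^bsub>B\<^esub> = \<zero>"
    using ring_iso assoc_algebra_image
    by (intro ring_hom_zero[OF _ B.ring_axioms]) (auto simp: ring_iso_def assoc_algebra_def)
  moreover have "h \<one>\<^bsub>B\<^esub> \<noteq> h \<zero>\<^bsub>B\<^esub>"
    using ring_iso_memE(5)[OF ring_iso] by (auto simp: bij_betw_def dest: inj_onD)
  ultimately show "\<one> \<noteq> \<zero>" by (simp add: hom_one)
qed

lemma reduced_norm_hom:
  assumes "u \<in> carrier B"
  shows "reduced_norm A (h u) = reduced_norm B u"
proof (rule reduced_norm_eqI)
  have "h u \<otimes> transported_conj (h u) = h (u \<otimes>\<^bsub>B\<^esub> s u)"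
    using assms by (simp add: transported_conj_hom hom_mult)
  then show "h u \<otimes> transported_conj (h u) = reduced_norm B u \<odot> \<one>"
    using assms by (simp add: B.mult_conj hom_smult hom_one)
qed (use assms in simp)

lemma reduced_trace_hom:
  assumes "u \<in> carrier B"
  shows "reduced_trace A (h u) = reduced_trace B u"
proof (rule reduced_trace_eqI)
  have "h u \<oplus> transported_conj (h u) = h (u \<oplus>\<^bsub>B\<^esub> s u)"
    using assms by (simp add: transported_conj_hom hom_add)
  then show "h u \<oplus> transported_conj (h u) = reduced_trace B u \<odot> \<one>"
    using assms by (simp add: B.add_conj hom_smult hom_one)
qed (use assms in simp)

end


section \<open>Hilbert symbols\<close>

lemma hilbert_algebra_type_simps [simp]:
  fixes a b :: "'k::comm_ring_1"
  shows
  "carrier (hilbert_algebra ring_of_type_algebra a b) = UNIV"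
  "(t, x, y, z) \<otimes>\<^bsub>hilbert_algebra ring_of_type_algebra a b\<^esub> (t', x', y', z') =
     (t * t' + a * (x * x') + b * (y * y') - a * b * (z * z'),
      t * x' + x * t' + b * (z * y') - b * (y * z'),
      t * y' + y * t' + a * (x * z') - a * (z * x'),
      t * z' + z * t' + x * y' - y * x')"
  "(t, x, y, z) \<oplus>\<^bsub>hilbert_algebra ring_of_type_algebra a b\<^esub> (t', x', y', z') =
     (t + t', x + x', y + y', z + z')"
  "\<one>\<^bsub>hilbert_algebra ring_of_type_algebra a b\<^esub> = (1, 0, 0, 0)"
  "\<zero>\<^bsub>hilbert_algebra ring_of_type_algebra a b\<^esub> = (0, 0, 0, 0)"
  "c \<odot>\<^bsub>hilbert_algebra ring_of_type_algebra a b\<^esub> (t, x, y, z) = (c * t, c * x, c * y, c * z)"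
  by (simp_all add: hilbert_algebra_def a_minus_def)

lemma assoc_algebra_hilbert_algebra:
  fixes a b :: "'k::field"
  shows "assoc_algebra ring_of_type_algebra (hilbert_algebra ring_of_type_algebra a b)"
proof -
  let ?K = "ring_of_type_algebra :: 'k ring"
  let ?H = "hilbert_algebra ring_of_type_algebra a b"
  have "abelian_group ?H"
  proof (rule abelian_groupI)
    fix v assume "v \<in> carrier ?H"
    obtain t x y z where "v = (t, x, y, z)" by (cases v)
    then show "\<exists>w\<in>carrier ?H. w \<oplus>\<^bsub>?H\<^esub> v = \<zero>\<^bsub>?H\<^esub>"
      by (intro bexI[of _ "(- t, - x, - y, - z)"]) simp_all
  qed (auto simp: add_ac)
  moreover have "monoid ?H"
    by (rule monoidI) (auto simp: algebra_simps)
  ultimately have "ring ?H"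
    by (intro ringI) (auto simp: algebra_simps)
  moreover have "module ?K ?H"
    by (rule moduleI[OF cring_from_type_algebra \<open>abelian_group ?H\<close>]) (auto simp: algebra_simps)
  ultimately show ?thesis
    by (auto simp: assoc_algebra_def algebra_simps intro: field_from_type_algebra)
qed

lemma standard_involution_hilbert_conj:
  "standard_involution (hilbert_algebra rat_field a b) (hilbert_conj rat_field)"
  by (simp add: standard_involution_def hilbert_conj_def algebra_simps) (metis diff_add_cancel)

lemma rat_involutive_algebra_hilbert:
  "rat_involutive_algebra (hilbert_algebra rat_field a b) (hilbert_conj rat_field)"
  by unfold_locales
    (simp_all add: assoc_algebra_hilbert_algebra standard_involution_hilbert_conj)

lemma reduced_norm_hilbert:
  "reduced_norm (hilbert_algebra rat_field a b) v = hilbert_norm rat_field a b v"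
proof -
  interpret rat_involutive_algebra "hilbert_algebra rat_field a b" "hilbert_conj rat_field"
    by (rule rat_involutive_algebra_hilbert)
  show ?thesis
    using cring.hilbert_mult_conj[OF cring_from_type_algebra, of a b v]
    by (intro reduced_norm_eqI) simp_all
qed

lemma reduced_trace_hilbert: "reduced_trace (hilbert_algebra rat_field a b) (t, x, y, z) = 2 * t"
proof -
  interpret rat_involutive_algebra "hilbert_algebra rat_field a b" "hilbert_conj rat_field"
    by (rule rat_involutive_algebra_hilbert)
  show ?thesis
    by (rule reduced_trace_eqI) (simp_all add: hilbert_conj_def)
qed

lemma has_hilbert_symbolE:
  fixes A :: "(rat, 'a, 'm) module_scheme"
  assumes "assoc_algebra rat_field A" "has_hilbert_symbol A a b"
  obtains h where
    "rat_involutive_algebra_iso (hilbert_algebra rat_field a b) (hilbert_conj rat_field) A h"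
proof -
  obtain h where "h \<in> algebra_iso rat_field (hilbert_algebra rat_field a b) A"
    using assms(2) by (auto simp: has_hilbert_symbol_def)
  then show ?thesis
    using that assms(1)
    by (simp add: rat_involutive_algebra_iso_def rat_involutive_algebra_iso_axioms_def
        rat_involutive_algebra_hilbert)
qed

lemma rat_quaternion_algebra_involutive:
  assumes "rat_quaternion_algebra A"
  obtains s where "rat_involutive_algebra A s"
proof -
  obtain a b where "assoc_algebra rat_field A" "has_hilbert_symbol A a b"
    using assms by (auto simp: rat_quaternion_algebra_def)
  then obtain h where
    "rat_involutive_algebra_iso (hilbert_algebra rat_field a b) (hilbert_conj rat_field) A h"
    by (rule has_hilbert_symbolE)
  then interpret rat_involutive_algebra_iso "hilbert_algebra rat_field a b" "hilbert_conj rat_field" A h .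
  show ?thesis by (rule that) (rule rat_involutive_algebra_axioms)
qed


section \<open>Integers of an algebra ramified at $p$\<close>

lemma ramified_trace_square_le_norm:
  assumes A: "rat_quaternion_algebra A" and p: "Factorial_Ring.prime p"
    and ramified: "ramified_at_prime p A" and x: "x \<in> carrier A"
  shows "padic_abs p (reduced_trace A x) ^ 2 \<le> padic_abs p (reduced_norm A x)"
proof -
  interpret padic: nonarchimedean_abs "padic_abs p" by (rule nonarchimedean_abs_padic_abs[OF p])
  obtain a b where symbol: "has_hilbert_symbol A a b"
    and skew: "skew_field (hilbert_algebra (padic_field p) (padic_of_rat p a) (padic_of_rat p b))"
    using ramified unfolding ramified_at_prime_def ramified_in_def by blast
  have "assoc_algebra rat_field A" using A by (simp add: rat_quaternion_algebra_def)
  then obtain h where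
    "rat_involutive_algebra_iso (hilbert_algebra rat_field a b) (hilbert_conj rat_field) A h"
    using symbol by (rule has_hilbert_symbolE)
  then interpret rat_involutive_algebra_iso "hilbert_algebra rat_field a b" "hilbert_conj rat_field" A h .
  obtain t u v w where "x = h (t, u, v, w)"
    using x by (auto simp: carrier_eq_image)
  then show ?thesis
    using padic.absval_trace_square_le_norm[of a b t u v w] skew
    by (simp add: padic_field_eq_completion[OF p] padic_of_rat_eq_completion_class[OF p]
        reduced_norm_hom reduced_trace_hom reduced_norm_hilbert reduced_trace_hilbert)
qed

theorem ramified_is_integer_smult_iff:
  assumes A: "rat_quaternion_algebra A" and p: "Factorial_Ring.prime p"
    and ramified: "ramified_at_prime p A" and x: "x \<in> carrier A" and norm: "reduced_norm A x \<in> \<int>"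
  shows "is_integer A (of_nat p \<odot>\<^bsub>A\<^esub> x) \<longleftrightarrow> is_integer A x"
proof -
  interpret padic: nonarchimedean_abs "padic_abs p" by (rule nonarchimedean_abs_padic_abs[OF p])
  obtain s where "rat_involutive_algebra A s"
    using A by (rule rat_quaternion_algebra_involutive)
  then interpret rat_involutive_algebra A s .
  have "padic_abs p (reduced_norm A x) \<le> 1"
    using norm padic.absval_of_int_le_one by (metis Ints_cases)
  then have "padic_abs p (reduced_trace A x) ^ 2 \<le> 1"
    using ramified_trace_square_le_norm[OF A p ramified x] by simp
  then have "padic_abs p (reduced_trace A x) \<le> 1"
    by (simp add: power_le_one_iff)
  then have "of_nat p * reduced_trace A x \<in> \<int> \<longleftrightarrow> reduced_trace A x \<in> \<int>"
    by (metis Ints_if_padic_abs_le_one[OF p] Ints_mult Ints_of_nat)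
  then show ?thesis
    using x norm by (simp add: is_integer_iff reduced_norm_smult reduced_trace_smult)
qed

lemma outlier_iff_bex_carrier:
  "outlier A m \<longleftrightarrow> m > 0 \<and> (\<exists>x\<in>carrier A. reduced_norm A x = of_nat m) \<and>
     \<not> (\<exists>x\<in>carrier A. is_integer A x \<and> reduced_norm A x = of_nat m)"
proof -
  have "x \<in> carrier A" if "is_integer A x" for x
    using that by (simp add: is_integer_def)
  then show ?thesis unfolding outlier_def by blast
qed

theorem theorem5p6:
  fixes A :: "(rat, 'a, 'm) module_scheme" and r :: nat
  assumes "rat_quaternion_algebra A"
    and "definite A"
    and "Factorial_Ring.prime r"
    and "ramified_at_prime r A"
  shows "\<forall>m::nat. m > 0 \<longrightarrow> (outlier A m \<longleftrightarrow> outlier A (m * r\<^sup>2))"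
proof (intro allI impI)
  fix m :: nat assume "m > 0"
  obtain s where "rat_involutive_algebra A s"
    using assms(1) by (rule rat_quaternion_algebra_involutive)
  then interpret rat_involutive_algebra A s .
  have "r > 0" using assms(3) by (rule prime_gt_0_nat)
  then have bex_norm_iff: "(\<exists>y\<in>carrier A. P y \<and> reduced_norm A y = of_nat (m * r\<^sup>2)) \<longleftrightarrow>
      (\<exists>x\<in>carrier A. P (of_nat r \<odot>\<^bsub>A\<^esub> x) \<and> reduced_norm A x = of_nat m)" for P
    using bex_reduced_norm_smult_iff[of "of_nat r" P "of_nat m"] by simp
  have "is_integer A (of_nat r \<odot>\<^bsub>A\<^esub> x) \<longleftrightarrow> is_integer A x"
    if "x \<in> carrier A" "reduced_norm A x = of_nat m" for x
    using ramified_is_integer_smult_iff[OF assms(1,3,4)] that by simp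
  then have "(\<exists>y\<in>carrier A. is_integer A y \<and> reduced_norm A y = of_nat (m * r\<^sup>2)) \<longleftrightarrow>
      (\<exists>x\<in>carrier A. is_integer A x \<and> reduced_norm A x = of_nat m)"
    unfolding bex_norm_iff by blast
  then show "outlier A m \<longleftrightarrow> outlier A (m * r\<^sup>2)"
    unfolding outlier_iff_bex_carrier using bex_norm_iff[of "\<lambda>_. True"] \<open>m > 0\<close> \<open>r > 0\<close> by simp
qed

end
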